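(* Let $\mathcal X,\mathcal Y$ be complex Hilbert spaces, let $E:\mathcal X\to\mathcal Y$ be a bounded linear operator and let $A:\mathcal D(A)\subseteq\mathcal X\to\mathcal Y$ be a closed, densely defined linear operator. If the operator pencil $\lambda E-A$ has a right singular polynomial, then there exists a nonzero $\mathcal X$-valued polynomial $f(\lambda)$ with $f(0)=0$ satisfying $f(t)\in\mathcal D(A)$ and $E\dot f(t)=Af(t)$ for all $t\in\mathbb R$.
   Context: An $\mathcal X$-valued polynomial is an expression $p(\lambda)=\sum_{j=0}^k\lambda^j a_j$ with $a_0,\dots,a_k\in\mathcal X$. It is called a right singular polynomial for the pencil $\lambda E-A$ if it is a nonzero polynomial, $p(\lambda_0)\in\mathcal D(E)\cap\mathcal D(A)$ and $(\lambda_0E-A)p(\lambda_0)=0$ for every $\lambda_0\in\mathbb C$. $\dot f$ denotes the derivative with respect to the real variable $t$. *)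

theory Defs
  imports "HOL-Analysis.Analysis" "HOL-Computational_Algebra.Polynomial"
begin

section \<open>Complex Hilbert spaces\<close>

text \<open>
  The libraries only provide real inner product spaces. A complex Hilbert space is a Banach space
  with a complex scalar multiplication extending the real one and a sesquilinear, positive definite
  form (linear in its first argument) that induces the norm. The underlying real normed structure
  is what the library uses for topology and for derivatives in a real variable.
\<close>

class complex_hilbert_space = banach +
  fixes scaleC :: "complex \<Rightarrow> 'a \<Rightarrow> 'a"  (infixr \<open>*\<^sub>C\<close> 75)
    and cinner :: "'a \<Rightarrow> 'a \<Rightarrow> complex"
  assumes scaleR_scaleC: "r *\<^sub>R x = complex_of_real r *\<^sub>C x"
    and scaleC_add_right: "a *\<^sub>C (x + y) = a *\<^sub>C x + a *\<^sub>C y"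
    and scaleC_add_left: "(a + b) *\<^sub>C x = a *\<^sub>C x + b *\<^sub>C x"
    and scaleC_scaleC: "a *\<^sub>C (b *\<^sub>C x) = (a * b) *\<^sub>C x"
    and scaleC_one: "1 *\<^sub>C x = x"
    and cinner_commute: "cinner x y = cnj (cinner y x)"
    and cinner_add_left: "cinner (x + y) z = cinner x z + cinner y z"
    and cinner_scaleC_left: "cinner (a *\<^sub>C x) y = a * cinner x y"
    and cinner_ge_zero: "Im (cinner x x) = 0 \<and> 0 \<le> Re (cinner x x)"
    and cinner_eq_zero_iff: "cinner x x = 0 \<longleftrightarrow> x = 0"
    and norm_eq_sqrt_cinner: "norm x = sqrt (Re (cinner x x))"

instantiation complex :: complex_hilbert_space
begin

definition scaleC_complex :: "complex \<Rightarrow> complex \<Rightarrow> complex"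
  where "scaleC_complex a x = a * x"

definition cinner_complex :: "complex \<Rightarrow> complex \<Rightarrow> complex"
  where "cinner_complex x y = x * cnj y"

instance
proof
  fix x y z a b :: complex and r :: real
  show "r *\<^sub>R x = complex_of_real r *\<^sub>C x"
    by (simp add: scaleC_complex_def scaleR_conv_of_real)
  show "a *\<^sub>C (x + y) = a *\<^sub>C x + a *\<^sub>C y"
    by (simp add: scaleC_complex_def distrib_left)
  show "(a + b) *\<^sub>C x = a *\<^sub>C x + b *\<^sub>C x"
    by (simp add: scaleC_complex_def distrib_right)
  show "a *\<^sub>C (b *\<^sub>C x) = (a * b) *\<^sub>C x"
    by (simp add: scaleC_complex_def)
  show "1 *\<^sub>C x = x"
    by (simp add: scaleC_complex_def)
  show "cinner x y = cnj (cinner y x)"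
    by (simp add: cinner_complex_def)
  show "cinner (x + y) z = cinner x z + cinner y z"
    by (simp add: cinner_complex_def distrib_right)
  show "cinner (a *\<^sub>C x) y = a * cinner x y"
    by (simp add: cinner_complex_def scaleC_complex_def)
  show "Im (cinner x x) = 0 \<and> 0 \<le> Re (cinner x x)"
    by (simp add: cinner_complex_def)
  show "cinner x x = 0 \<longleftrightarrow> x = 0"
    by (simp add: cinner_complex_def)
  show "norm x = sqrt (Re (cinner x x))"
    by (simp add: cinner_complex_def cmod_def power2_eq_square)
qed

end

section \<open>Linear operators\<close>

definition bounded_clinear ::
    "('a::complex_hilbert_space \<Rightarrow> 'b::complex_hilbert_space) \<Rightarrow> bool"
  where "bounded_clinear E \<longleftrightarrow> bounded_linear E \<and> (\<forall>c x. E (c *\<^sub>C x) = c *\<^sub>C E x)"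

definition csubspace :: "'a::complex_hilbert_space set \<Rightarrow> bool"
  where "csubspace D \<longleftrightarrow>
    0 \<in> D \<and> (\<forall>x\<in>D. \<forall>y\<in>D. x + y \<in> D) \<and> (\<forall>c. \<forall>x\<in>D. c *\<^sub>C x \<in> D)"

text \<open>
  An operator with domain \<open>D\<close> is a function of which only the values on \<open>D\<close> matter.
\<close>

definition clinear_operator_on ::
    "'a::complex_hilbert_space set \<Rightarrow> ('a \<Rightarrow> 'b::complex_hilbert_space) \<Rightarrow> bool"
  where "clinear_operator_on D A \<longleftrightarrow> csubspace D \<and>
    (\<forall>x\<in>D. \<forall>y\<in>D. A (x + y) = A x + A y) \<and> (\<forall>c. \<forall>x\<in>D. A (c *\<^sub>C x) = c *\<^sub>C A x)"

definition closed_operator_on ::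
    "'a::complex_hilbert_space set \<Rightarrow> ('a \<Rightarrow> 'b::complex_hilbert_space) \<Rightarrow> bool"
  where "closed_operator_on D A \<longleftrightarrow> closed {(x, A x) |x. x \<in> D}"

definition densely_defined_on :: "'a::complex_hilbert_space set \<Rightarrow> bool"
  where "densely_defined_on D \<longleftrightarrow> closure D = UNIV"

section \<open>Vector-valued polynomials\<close>

text \<open>
  The type \<^typ>\<open>'a poly\<close> only needs a zero on the coefficients, but the library evaluation
  \<^const>\<open>poly\<close> needs a commutative semiring of coefficients. Hence a separate evaluation at complex
  scalars.
\<close>

definition vpoly :: "'a::complex_hilbert_space poly \<Rightarrow> complex \<Rightarrow> 'a"
  where "vpoly p z = (\<Sum>j\<le>degree p. z ^ j *\<^sub>C coeff p j)"

text \<open>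
  In particular \<^const>\<open>vector_derivative\<close> is the genuine derivative for a polynomial in a
  real variable:
\<close>

lemma vpoly_differentiable:
  "(\<lambda>t::real. vpoly p (complex_of_real t)) differentiable (at t)"
proof -
  have "(\<lambda>t::real. vpoly p (complex_of_real t)) =
      (\<lambda>t. \<Sum>j\<le>degree p. t ^ j *\<^sub>R coeff p j)"
    by (simp add: vpoly_def scaleR_scaleC)
  moreover have "(\<lambda>t::real. t ^ j *\<^sub>R coeff p j) differentiable (at t)" for j
    by (rule differentiable_scaleR) (simp_all add: differentiable_power)
  ultimately show ?thesis
    by (simp add: differentiable_sum)
qed

definition right_singular_polynomial ::
    "'a::complex_hilbert_space set \<Rightarrow> ('a \<Rightarrow> 'b::complex_hilbert_space) \<Rightarrow>
     'a set \<Rightarrow> ('a \<Rightarrow> 'b) \<Rightarrow> 'a poly \<Rightarrow> bool"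
  where "right_singular_polynomial DE E DA A p \<longleftrightarrow> p \<noteq> 0 \<and>
    (\<forall>z. vpoly p z \<in> DE \<inter> DA \<and> z *\<^sub>C E (vpoly p z) - A (vpoly p z) = 0)"

end

theory Submission
  imports Defs
begin

text \<open>
  Write the right singular polynomial as \<open>p(\<lambda>) = \<Sum>j\<le>k. \<lambda>\<^sup>j a\<^sub>j\<close> with \<open>a\<^sub>k \<noteq> 0\<close>. Its coefficients form
  a singular chain: all \<open>a\<^sub>j\<close> lie in the domain of \<open>A\<close>, and comparing powers of \<open>\<lambda>\<close> in
  \<open>\<lambda> E p(\<lambda>) = A p(\<lambda>)\<close> gives \<open>A a\<^sub>0 = 0\<close>, \<open>A a\<^bsub>j+1\<^esub> = E a\<^sub>j\<close> and \<open>E a\<^sub>k = 0\<close>. Traversing this chain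
  backwards with the weights of the exponential series,
  \<open>f(t) = \<Sum>j\<le>k. t\<^bsup>k+1-j\<^esup> / (k+1-j)! a\<^sub>j\<close>,
  yields the solution: differentiating turns the weight of \<open>a\<^sub>j\<close> into the weight of \<open>a\<^bsub>j+1\<^esub>\<close>, so
  that \<open>E f'(t)\<close> and \<open>A f(t)\<close> agree term by term, the two ends of the chain contributing zero. The
  coefficient of \<open>t\<close> in \<open>f\<close> is \<open>a\<^sub>k\<close>, whence \<open>f \<noteq> 0\<close>.

  Both facts about the chain are instances of \<open>coeffs_in_csubspace\<close>: a polynomial whose values all
  lie in a complex subspace has its coefficients there. It is applied to the domain of \<open>A\<close> and to
  the zero subspace.
\<close>

section \<open>Complex subspaces and linear operators\<close>

lemma scaleC_zero_right [simp]: "c *\<^sub>C (0::'a::complex_hilbert_space) = 0"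
  using scaleC_add_right[of c 0 "0::'a"] by simp

lemma scaleC_zero_left [simp]: "0 *\<^sub>C (x::'a::complex_hilbert_space) = 0"
  using scaleR_scaleC[of 0 x] by simp

lemma scaleC_minus_right:
  fixes x :: "'a::complex_hilbert_space"
  shows "c *\<^sub>C (- x) = - (c *\<^sub>C x)"
  using scaleC_add_right[of c x "- x"] by (simp add: eq_neg_iff_add_eq_0 add.commute)

lemma scaleC_diff_right:
  fixes x y :: "'a::complex_hilbert_space"
  shows "c *\<^sub>C (x - y) = c *\<^sub>C x - c *\<^sub>C y"
  using scaleC_add_right[of c x "- y"] by (simp add: scaleC_minus_right)

lemma scaleC_diff_left:
  fixes x :: "'a::complex_hilbert_space"
  shows "(a - b) *\<^sub>C x = a *\<^sub>C x - b *\<^sub>C x"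
  using scaleC_add_left[of "a - b" b x] by (simp add: algebra_simps)

lemma scaleC_sum_right:
  fixes x :: "'i \<Rightarrow> 'a::complex_hilbert_space"
  shows "c *\<^sub>C (\<Sum>i\<in>I. x i) = (\<Sum>i\<in>I. c *\<^sub>C x i)"
  by (induction I rule: infinite_finite_induct) (simp_all add: scaleC_add_right)

lemma csubspace_scaleC: "csubspace S \<Longrightarrow> x \<in> S \<Longrightarrow> c *\<^sub>C x \<in> S"
  by (simp add: csubspace_def)

lemma csubspace_add: "csubspace S \<Longrightarrow> x \<in> S \<Longrightarrow> y \<in> S \<Longrightarrow> x + y \<in> S"
  by (simp add: csubspace_def)

lemma csubspace_diff:
  assumes "csubspace S" "x \<in> S" "y \<in> S"
  shows "x - y \<in> S"
proof -
  have "(-1) *\<^sub>C y = - y"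
    using scaleR_scaleC[of "-1" y] by simp
  then have "- y \<in> S"
    using csubspace_scaleC[OF assms(1,3), of "-1"] by simp
  from csubspace_add[OF assms(1,2) this] show ?thesis by simp
qed

lemma csubspace_sum:
  assumes "csubspace S" "\<And>i. i \<in> I \<Longrightarrow> x i \<in> S"
  shows "(\<Sum>i\<in>I. x i) \<in> S"
  using assms(2)
  by (induction I rule: infinite_finite_induct)
    (use assms(1) in \<open>auto simp: csubspace_def\<close>)

lemma csubspace_singleton_zero: "csubspace {0}"
  by (simp add: csubspace_def)

lemma clinear_operator_on_sum:
  assumes A: "clinear_operator_on D A" and x: "\<And>i. i \<in> I \<Longrightarrow> x i \<in> D"
  shows "A (\<Sum>i\<in>I. c i *\<^sub>C x i) = (\<Sum>i\<in>I. c i *\<^sub>C A (x i))"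
proof -
  have S: "csubspace D" using A by (simp add: clinear_operator_on_def)
  then have "A (0 *\<^sub>C 0) = 0 *\<^sub>C A 0"
    using A unfolding clinear_operator_on_def csubspace_def by blast
  then have zero: "A 0 = 0" by simp
  show ?thesis
    using x
  proof (induction I rule: infinite_finite_induct)
    case (insert i I)
    have "c i *\<^sub>C x i \<in> D" "(\<Sum>i\<in>I. c i *\<^sub>C x i) \<in> D"
      using insert.prems by (auto intro!: csubspace_sum[OF S] csubspace_scaleC[OF S])
    then have "A (c i *\<^sub>C x i + (\<Sum>i\<in>I. c i *\<^sub>C x i))
        = c i *\<^sub>C A (x i) + A (\<Sum>i\<in>I. c i *\<^sub>C x i)"
      using A insert.prems by (simp add: clinear_operator_on_def)
    with insert show ?case by simp
  qed (simp_all add: zero)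
qed

lemma bounded_clinear_imp_clinear_operator_on:
  "bounded_clinear E \<Longrightarrow> clinear_operator_on UNIV E"
  by (simp add: bounded_clinear_def clinear_operator_on_def csubspace_def
      bounded_linear.linear linear_add)

section \<open>Vector-valued polynomials\<close>

text \<open>
  For \<open>q(z) = \<Sum>j\<le>n. z\<^sup>j b\<^sub>j\<close>, the combination \<open>q(2z) - 2\<^sup>n q(z)\<close> removes the term of degree \<open>n\<close> and multiplies each lower
  coefficient by a nonzero constant, which allows induction on the degree. With \<open>S = {0}\<close> this is
  the identity principle for vector-valued polynomials.
\<close>

lemma coeffs_in_csubspace:
  fixes b :: "nat \<Rightarrow> 'a::complex_hilbert_space"
  assumes S: "csubspace S"
    and vals: "\<And>z. (\<Sum>j\<le>n. z ^ j *\<^sub>C b j) \<in> S"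
  shows "j \<le> n \<Longrightarrow> b j \<in> S"
  using vals
proof (induction n arbitrary: b j)
  case 0
  then show ?case
    using "0.prems"(2)[of 1] by (simp add: scaleC_one)
next
  case (Suc n)
  let ?w = "\<lambda>j. 2 ^ j - 2 ^ Suc n :: complex"
  have lower: "b j \<in> S" if "j \<le> n" for j
  proof -
    have "(\<Sum>j\<le>n. z ^ j *\<^sub>C (?w j *\<^sub>C b j)) \<in> S" for z
    proof -
      have "(\<Sum>j\<le>Suc n. (2 * z) ^ j *\<^sub>C b j) - 2 ^ Suc n *\<^sub>C (\<Sum>j\<le>Suc n. z ^ j *\<^sub>C b j)
          = (\<Sum>j\<le>Suc n. (2 * z) ^ j *\<^sub>C b j - (2 ^ Suc n * z ^ j) *\<^sub>C b j)"
        by (simp only: scaleC_sum_right scaleC_scaleC sum_subtractf)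
      also have "\<dots> = (\<Sum>j\<le>Suc n. z ^ j *\<^sub>C (?w j *\<^sub>C b j))"
        by (intro sum.cong refl)
          (simp add: scaleC_scaleC scaleC_diff_left[symmetric] power_mult_distrib right_diff_distrib
            ac_simps)
      also have "\<dots> = (\<Sum>j\<le>n. z ^ j *\<^sub>C (?w j *\<^sub>C b j))"
        by simp
      finally show ?thesis
        using csubspace_diff[OF S Suc.prems(2)[of "2 * z"]
            csubspace_scaleC[OF S Suc.prems(2)[of z], of "2 ^ Suc n"]]
        by simp
    qed
    from Suc.IH[OF that this] have "?w j *\<^sub>C b j \<in> S" .
    from csubspace_scaleC[OF S this, of "inverse (?w j)"]
    have "(inverse (?w j) * ?w j) *\<^sub>C b j \<in> S"
      by (simp only: scaleC_scaleC)
    moreover have "?w j \<noteq> 0"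
    proof -
      have "(2::real) ^ j \<noteq> 2 ^ Suc n"
        using that by (subst power_inject_exp) auto
      then have "complex_of_real (2 ^ j) \<noteq> complex_of_real (2 ^ Suc n)"
        by (simp only: of_real_eq_iff not_False_eq_True)
      then show ?thesis by simp
    qed
    ultimately show ?thesis
      by (simp only: left_inverse not_False_eq_True scaleC_one)
  qed
  have "(\<Sum>j\<le>Suc n. b j) \<in> S"
    using Suc.prems(2)[of 1] by (simp add: scaleC_one)
  moreover have "(\<Sum>j\<le>n. b j) \<in> S"
    using lower by (intro csubspace_sum S) simp
  ultimately have "(\<Sum>j\<le>Suc n. b j) - (\<Sum>j\<le>n. b j) \<in> S"
    by (rule csubspace_diff[OF S])
  then have "b (Suc n) \<in> S" by simp
  with lower Suc.prems(1) show ?case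
    by (auto simp: le_Suc_eq)
qed

lemma vpoly_altdef:
  assumes "degree p \<le> n"
  shows "vpoly p z = (\<Sum>j\<le>n. z ^ j *\<^sub>C coeff p j)"
  unfolding vpoly_def
  using assms by (intro sum.mono_neutral_left) (auto simp: coeff_eq_0)

lemma vpoly_of_real:
  assumes "degree p \<le> n"
  shows "vpoly p (complex_of_real t) = (\<Sum>j\<le>n. t ^ j *\<^sub>R coeff p j)"
  by (simp add: vpoly_altdef[OF assms] scaleR_scaleC)

lemma vector_derivative_vpoly:
  fixes p :: "'a::complex_hilbert_space poly"
  assumes "degree p \<le> Suc n"
  shows "vector_derivative (\<lambda>s::real. vpoly p (complex_of_real s)) (at t)
    = (\<Sum>j\<le>n. (real (Suc j) * t ^ j) *\<^sub>R coeff p (Suc j))"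
proof -
  have "((\<lambda>s. \<Sum>j\<le>Suc n. s ^ j *\<^sub>R coeff p j) has_vector_derivative
      (\<Sum>j\<le>Suc n. (real j * t ^ (j - 1)) *\<^sub>R coeff p j)) (at t)"
    by (intro has_vector_derivative_sum)
      (auto intro!: derivative_eq_intros simp: has_vector_derivative_def has_field_derivative_def
        algebra_simps)
  also have "(\<Sum>j\<le>Suc n. (real j * t ^ (j - 1)) *\<^sub>R coeff p j)
      = (\<Sum>j\<le>n. (real (Suc j) * t ^ j) *\<^sub>R coeff p (Suc j))"
    by (simp only: sum.atMost_Suc_shift) simp
  finally show ?thesis
    by (simp add: vpoly_of_real[OF assms] vector_derivative_at del: sum.atMost_Suc)
qed

section \<open>Singular chains\<close>

text \<open>
  The polynomial with coefficients \<open>E a\<^bsub>j-1\<^esub> - A a\<^sub>j\<close>, where \<open>a\<^bsub>-1\<^esub> = 0\<close>, vanishes identically. The equation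
  \<open>E a\<^sub>k = 0\<close> at the end of the chain is the case \<open>j = degree p = k\<close> of \<open>chain_step\<close>, since
  \<open>a\<^bsub>k+1\<^esub> = 0\<close>.
\<close>

lemma right_singular_polynomial_chain:
  fixes E :: "'a::complex_hilbert_space \<Rightarrow> 'b::complex_hilbert_space"
  assumes E: "bounded_clinear E" and A: "clinear_operator_on D A"
    and p: "right_singular_polynomial UNIV E D A p"
  shows coeff_in_domain: "coeff p j \<in> D"
    and chain_start: "A (coeff p 0) = 0"
    and chain_step: "j \<le> degree p \<Longrightarrow> A (coeff p (Suc j)) = E (coeff p j)"
proof -
  define k where "k = degree p"
  have S: "csubspace D" using A by (simp add: clinear_operator_on_def)
  have value_in_D: "vpoly p z \<in> D" and eq: "z *\<^sub>C E (vpoly p z) = A (vpoly p z)" for z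
    using p by (simp_all add: right_singular_polynomial_def)
  have in_D: "coeff p j \<in> D" for j
  proof (cases "j \<le> k")
    case True
    then show ?thesis
      using value_in_D coeffs_in_csubspace[OF S, where b = "coeff p" and n = k] True
      by (simp add: vpoly_def k_def)
  next
    case False
    then show ?thesis using S by (simp add: coeff_eq_0 k_def csubspace_def)
  qed
  then show "coeff p j \<in> D" .
  define b where "b j = (case j of 0 \<Rightarrow> 0 | Suc i \<Rightarrow> E (coeff p i)) - A (coeff p j)" for j
  have "(\<Sum>j\<le>Suc k. z ^ j *\<^sub>C b j) \<in> {0}" for z
  proof -
    have "(\<Sum>j\<le>Suc k. z ^ j *\<^sub>C b j)
        = (\<Sum>j\<le>Suc k. z ^ j *\<^sub>C (case j of 0 \<Rightarrow> 0 | Suc i \<Rightarrow> E (coeff p i)))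
          - (\<Sum>j\<le>Suc k. z ^ j *\<^sub>C A (coeff p j))"
      by (simp only: b_def scaleC_diff_right sum_subtractf)
    also have "(\<Sum>j\<le>Suc k. z ^ j *\<^sub>C (case j of 0 \<Rightarrow> 0 | Suc i \<Rightarrow> E (coeff p i)))
        = z *\<^sub>C (\<Sum>j\<le>k. z ^ j *\<^sub>C E (coeff p j))"
      by (simp only: sum.atMost_Suc_shift) (simp add: scaleC_sum_right scaleC_scaleC)
    also have "(\<Sum>j\<le>k. z ^ j *\<^sub>C E (coeff p j)) = E (vpoly p z)"
      unfolding vpoly_def k_def
      by (rule clinear_operator_on_sum[symmetric])
        (auto intro: bounded_clinear_imp_clinear_operator_on E)
    also have "(\<Sum>j\<le>Suc k. z ^ j *\<^sub>C A (coeff p j)) = A (vpoly p z)"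
    proof -
      have "degree p \<le> Suc k" by (simp add: k_def)
      then show ?thesis
        by (simp only: vpoly_altdef clinear_operator_on_sum[OF A in_D])
    qed
    finally show ?thesis by (simp add: eq)
  qed
  then have "b j \<in> {0}" if "j \<le> Suc k" for j
    by (rule coeffs_in_csubspace[OF csubspace_singleton_zero _ that])
  then have b_zero: "b j = 0" if "j \<le> Suc k" for j
    using that by blast
  show "A (coeff p 0) = 0"
    using b_zero[of 0] by (simp add: b_def)
  show "A (coeff p (Suc j)) = E (coeff p j)" if "j \<le> degree p"
    using b_zero[of "Suc j"] that by (simp add: b_def k_def)
qed

theorem corollary36:
  fixes E :: "'a::complex_hilbert_space \<Rightarrow> 'b::complex_hilbert_space"
    and A :: "'a \<Rightarrow> 'b" and D :: "'a set"
  assumes "bounded_clinear E"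
    and "clinear_operator_on D A"
    and "closed_operator_on D A"
    and "densely_defined_on D"
    and "\<exists>p. right_singular_polynomial UNIV E D A p"
  shows "\<exists>f :: 'a poly. f \<noteq> 0 \<and> vpoly f 0 = 0 \<and>
    (\<forall>t::real. vpoly f (complex_of_real t) \<in> D \<and>
      E (vector_derivative (\<lambda>s::real. vpoly f (complex_of_real s)) (at t))
        = A (vpoly f (complex_of_real t)))"
proof -
  from assms(5) obtain p where p: "right_singular_polynomial UNIV E D A p" by blast
  define k where "k = degree p"
  let ?a = "coeff p"
  note in_D = coeff_in_domain[OF assms(1,2) p]
  have S: "csubspace D" using assms(2) by (simp add: clinear_operator_on_def)
  interpret E: bounded_linear E
    using assms(1) by (simp add: bounded_clinear_def)
  define c where "c m = (1 / fact m) *\<^sub>R ?a (Suc k - m)" for m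
  define f where "f = Poly (map c [0..<Suc (Suc k)])"
  have coeff_f: "coeff f m = c m" if "m \<le> Suc k" for m
    using that by (simp add: f_def nth_default_def del: upt_Suc)
  have degree_f: "degree f \<le> Suc k"
    by (rule degree_le) (simp add: f_def nth_default_def del: upt_Suc)
  have "f \<noteq> 0"
  proof -
    have "coeff f 1 = ?a k" by (simp add: coeff_f c_def)
    moreover have "?a k \<noteq> 0"
      using p by (simp add: k_def right_singular_polynomial_def)
    ultimately show ?thesis by auto
  qed
  moreover have "vpoly f 0 = 0"
  proof -
    \<comment> \<open>The constant term carries \<open>?a (Suc k)\<close>, which is beyond the degree of \<open>p\<close>.\<close>
    have "coeff f 0 = 0" by (simp add: coeff_f c_def k_def coeff_eq_0)
    then show ?thesis
      by (simp add: vpoly_altdef[OF degree_f] sum.atMost_Suc_shift del: sum.atMost_Suc)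
  qed
  moreover have "vpoly f (complex_of_real t) \<in> D" for t
    unfolding vpoly_altdef[OF degree_f]
    by (intro csubspace_sum[OF S] csubspace_scaleC[OF S])
      (simp add: coeff_f c_def scaleR_scaleC csubspace_scaleC[OF S] in_D)
  moreover have "E (vector_derivative (\<lambda>s::real. vpoly f (complex_of_real s)) (at t))
        = A (vpoly f (complex_of_real t))" for t
  proof -
    have "E (vector_derivative (\<lambda>s::real. vpoly f (complex_of_real s)) (at t))
        = E (\<Sum>m\<le>k. (t ^ m / fact m) *\<^sub>R ?a (k - m))"
      unfolding vector_derivative_vpoly[OF degree_f]
      by (intro arg_cong[of _ _ E] sum.cong)
        (simp_all add: coeff_f c_def field_simps del: of_nat_Suc)
    also have "\<dots> = (\<Sum>m\<le>k. (t ^ m / fact m) *\<^sub>R E (?a (k - m)))"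
      by (simp add: E.sum E.scaleR)
    also have "\<dots> = (\<Sum>m\<le>k. (t ^ m / fact m) *\<^sub>R A (?a (Suc k - m)))"
      by (intro sum.cong)
        (simp_all add: chain_step[OF assms(1,2) p] k_def Suc_diff_le)
    \<comment> \<open>The term for \<open>m = Suc k\<close> can be added since \<open>A (?a 0) = 0\<close>.\<close>
    also have "\<dots> = (\<Sum>m\<le>Suc k. (t ^ m / fact m) *\<^sub>R A (?a (Suc k - m)))"
      by (simp add: chain_start[OF assms(1,2) p])
    also have "\<dots> = A (\<Sum>m\<le>Suc k. (t ^ m / fact m) *\<^sub>R ?a (Suc k - m))"
      unfolding scaleR_scaleC by (rule clinear_operator_on_sum[OF assms(2) in_D, symmetric])
    also have "(\<Sum>m\<le>Suc k. (t ^ m / fact m) *\<^sub>R ?a (Suc k - m)) = vpoly f (complex_of_real t)"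
      unfolding vpoly_of_real[OF degree_f]
      by (intro sum.cong) (simp_all add: coeff_f c_def)
    finally show ?thesis .
  qed
  ultimately show ?thesis by blast
qed

end
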